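(* Let $n\ge1$ and let $L_n$ be the linear octagonal-quadrilateral network. Put $A=15+4\sqrt{14}$, $B=15-4\sqrt{14}$. Then the number of spanning trees of $L_n$ is \[ \tau(L_n)=\frac{4^{4n}\big[(116+31\sqrt{14})A^{n-1}-(116-31\sqrt{14})B^{n-1}\big]}{\sqrt{14}\,(8n+2)}\prod_{k=2}^{4n+1}\sin^{2}\Big(\frac{\pi(k-1)}{8n+2}\Big). \]
   Context: The linear octagonal-quadrilateral network $L_n$ is the simple graph with $8n+2$ vertices $1,2,\dots,4n+1$ and $1',2',\dots,(4n+1)'$, and $10n+1$ edges: $\{j,j+1\}$ and $\{j',(j+1)'\}$ for $1\le j\le 4n$, together with the edges $\{j,j'\}$ for $j=1$ and for every $j$ with $4\le j\le 4n+1$ and $j\equiv 0$ or $1\pmod 4$. $\tau(G)$ denotes the complexity of $G$, i.e. the number of spanning trees of $G$. *)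

theory Defs
  imports Complex_Main
begin

text \<open>
  Undirected simple graphs. Edges are two-element sets of vertices, so that there are neither
  loops nor parallel edges nor orientations.
\<close>

record 'v ugraph =
  uverts :: "'v set"
  uedges :: "'v set set"

definition simple_ugraph :: "'v ugraph \<Rightarrow> bool" where
  "simple_ugraph G \<longleftrightarrow>
     finite (uverts G) \<and> (\<forall>e\<in>uedges G. e \<subseteq> uverts G \<and> card e = 2)"

definition uwalk :: "'v ugraph \<Rightarrow> 'v list \<Rightarrow> bool" where
  "uwalk G xs \<longleftrightarrow>
     xs \<noteq> [] \<and> set xs \<subseteq> uverts G \<and> successively (\<lambda>u v. {u, v} \<in> uedges G) xs"

definition uconnected :: "'v ugraph \<Rightarrow> bool" where
  "uconnected G \<longleftrightarrow> uverts G \<noteq> {} \<and>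
     (\<forall>u\<in>uverts G. \<forall>v\<in>uverts G. \<exists>xs. uwalk G xs \<and> hd xs = u \<and> last xs = v)"

text \<open>
  A cycle is listed without repeating its starting vertex. The length bound keeps
  a single edge, traversed back and forth, from being a cycle.
\<close>

definition ucycle :: "'v ugraph \<Rightarrow> 'v list \<Rightarrow> bool" where
  "ucycle G xs \<longleftrightarrow>
     uwalk G xs \<and> distinct xs \<and> length xs \<ge> 3 \<and> {last xs, hd xs} \<in> uedges G"

definition utree :: "'v ugraph \<Rightarrow> bool" where
  "utree T \<longleftrightarrow> simple_ugraph T \<and> uconnected T \<and> (\<nexists>xs. ucycle T xs)"

definition spanning_utree :: "'v ugraph \<Rightarrow> 'v ugraph \<Rightarrow> bool" where
  "spanning_utree T G \<longleftrightarrow> utree T \<and> uverts T = uverts G \<and> uedges T \<subseteq> uedges G"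

definition complexity :: "'v ugraph \<Rightarrow> nat" where
  "complexity G = card {T. spanning_utree T G}"

text \<open>\<open>Plain j\<close> is the vertex $j$ and \<open>Primed j\<close> is the vertex $j'$.\<close>

datatype vertex = Plain nat | Primed nat

definition oct_quad_network :: "nat \<Rightarrow> vertex ugraph" where
  "oct_quad_network n =
     \<lparr>uverts = Plain ` {1..4*n+1} \<union> Primed ` {1..4*n+1},
      uedges = {{Plain j, Plain (j+1)} | j. 1 \<le> j \<and> j \<le> 4*n}
             \<union> {{Primed j, Primed (j+1)} | j. 1 \<le> j \<and> j \<le> 4*n}
             \<union> {{Plain j, Primed j} | j.
                  j = 1 \<or> (4 \<le> j \<and> j \<le> 4*n+1 \<and> (j mod 4 = 0 \<or> j mod 4 = 1))}\<rparr>"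

lemma simple_ugraph_oct_quad_network: "simple_ugraph (oct_quad_network n)"
  by (auto simp: simple_ugraph_def oct_quad_network_def)

lemma finite_spanning_utrees:
  assumes "simple_ugraph G"
  shows "finite {T. spanning_utree T G}"
proof -
  have "uedges G \<subseteq> Pow (uverts G)"
    using assms by (auto simp: simple_ugraph_def)
  then have fin: "finite (uedges G)"
    using assms by (auto simp: simple_ugraph_def intro: finite_subset)
  have "{T. spanning_utree T G} \<subseteq> (\<lambda>F. \<lparr>uverts = uverts G, uedges = F\<rparr>) ` Pow (uedges G)"
  proof
    fix T :: "'a ugraph" assume "T \<in> {T. spanning_utree T G}"
    then have "uverts T = uverts G" "uedges T \<in> Pow (uedges G)"
      by (auto simp: spanning_utree_def)
    moreover have "T = \<lparr>uverts = uverts T, uedges = uedges T\<rparr>"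
      by simp
    ultimately show "T \<in> (\<lambda>F. \<lparr>uverts = uverts G, uedges = F\<rparr>) ` Pow (uedges G)"
      by (metis image_eqI)
  qed
  then show ?thesis
    using fin by (meson finite_Pow_iff finite_imageI finite_subset)
qed

lemma card_uverts_oct_quad_network: "card (uverts (oct_quad_network n)) = 8*n+2"
proof -
  have "card (Plain ` {1..4*n+1} \<union> Primed ` {1..4*n+1})
      = card (Plain ` {1..4*n+1}) + card (Primed ` {1..4*n+1})"
    by (rule card_Un_disjoint) auto
  then show ?thesis
    by (simp add: oct_quad_network_def card_image inj_on_def)
qed

lemma card_uedges_oct_quad_network:
  assumes "n \<ge> 1"
  shows "card (uedges (oct_quad_network n)) = 10*n+1"
proof -
  define J where "J n = {j::nat. j = 1 \<or> (4 \<le> j \<and> j \<le> 4*n+1 \<and> (j mod 4 = 0 \<or> j mod 4 = 1))}" for n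
  have J: "finite (J n) \<and> card (J n) = 2*n+1" for n
  proof (induction n)
    case 0
    have "J 0 = {1}" by (auto simp: J_def)
    then show ?case by simp
  next
    case (Suc n)
    have "J (Suc n) = insert (4*n+4) (insert (4*n+5) (J n))"
      unfolding J_def by auto presburger+
    moreover have "4*n+4 \<notin> J n" "4*n+5 \<notin> J n" by (auto simp: J_def)
    ultimately show ?case using Suc by simp
  qed
  define P where "P = (\<lambda>j. {Plain j, Plain (j+1)}) ` {1..4*n}"
  define Q where "Q = (\<lambda>j. {Primed j, Primed (j+1)}) ` {1..4*n}"
  define R where "R = (\<lambda>j. {Plain j, Primed j}) ` J n"
  have "uedges (oct_quad_network n) = P \<union> Q \<union> R"
    unfolding oct_quad_network_def P_def Q_def R_def J_def by auto
  moreover have "card P = 4*n" "card Q = 4*n"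
    unfolding P_def Q_def by (subst card_image; auto simp: inj_on_def doubleton_eq_iff)+
  moreover have "card R = 2*n+1"
    unfolding R_def using J by (subst card_image) (auto simp: inj_on_def doubleton_eq_iff)
  moreover have "finite P" "finite Q" "finite R"
    using J by (auto simp: P_def Q_def R_def)
  moreover have "P \<inter> Q = {}" "(P \<union> Q) \<inter> R = {}"
    by (auto simp: P_def Q_def R_def doubleton_eq_iff)
  ultimately show ?thesis by (simp add: card_Un_disjoint)
qed

end

theory Submission
  imports Defs "HOL-Computational_Algebra.Polynomial"
begin

text \<open>
  For a graph with two marked vertices \<open>x\<close>, \<open>y\<close> let \<open>a\<close> be the number of its spanning trees and
  \<open>b\<close> the number of spanning forests that become a tree once \<open>{x, y}\<close> is added. Moving the mark
  from \<open>x\<close> to a new pendant neighbour of \<open>x\<close> turns \<open>(a, b)\<close> into \<open>(a, a + b)\<close>, and adding the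
  edge \<open>{x, y}\<close> turns it into \<open>(a + b, b)\<close>. The network grows from the single edge \<open>{1, 1'}\<close>, where
  \<open>(a, b) = (1, 1)\<close>, by these two operations, and an octagon followed by a quadrilateral acts as
  the matrix with rows \<open>(27, 4)\<close> and \<open>(20, 3)\<close>, whose eigenvalues are \<open>A\<close> and \<open>B\<close>. The product of
  sines is merely the constant \<open>(4n+1) / 4^(4n)\<close>: evaluate
  \<open>1 + z + \<dots> + z^(N-1) = \<Prod> (z - \<omega>)\<close>, over the \<open>N\<close>-th roots of unity \<open>\<omega> \<noteq> 1\<close>, at \<open>z = 1\<close>.
\<close>

subsection \<open>Trees in terms of reachability\<close>

definition reach :: "'v set set \<Rightarrow> 'v \<Rightarrow> 'v \<Rightarrow> bool" where
  "reach F = (\<lambda>u v. {u, v} \<in> F)\<^sup>*\<^sup>*"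

text \<open>Every edge is a bridge. For sets of two-element edges this is the absence of cycles, but
  phrased by reachability alone, so that the local modifications below need no surgery on
  cycles.\<close>

definition acyclic_edges :: "'v set set \<Rightarrow> bool" where
  "acyclic_edges F \<longleftrightarrow> (\<forall>u v. {u, v} \<in> F \<longrightarrow> \<not> reach (F - {{u, v}}) u v)"

abbreviation tree_on :: "'v set \<Rightarrow> 'v set set \<Rightarrow> bool" where
  "tree_on V F \<equiv> utree \<lparr>uverts = V, uedges = F\<rparr>"

lemma reach_refl [simp]: "reach F u u"
  by (simp add: reach_def)

lemma reach_edge: "{u, v} \<in> F \<Longrightarrow> reach F u v"
  by (auto simp: reach_def)

lemma reach_trans: "reach F u v \<Longrightarrow> reach F v w \<Longrightarrow> reach F u w"
  by (auto simp: reach_def)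

lemma reach_sym: "reach F u v \<Longrightarrow> reach F v u"
  using symp_rtranclp[of "\<lambda>u v. {u, v} \<in> F"]
  by (auto simp: reach_def symp_def insert_commute)

lemma reach_doubleton: "{u, v} = {x, y} \<Longrightarrow> reach F u v \<longleftrightarrow> reach F x y"
  by (metis doubleton_eq_iff reach_sym)

text \<open>Collapsing a pendant or subdividing vertex onto a neighbour is such a map \<open>f\<close>.\<close>

lemma reach_image:
  assumes "reach E a b" "\<And>u v. {u, v} \<in> E \<Longrightarrow> reach H (f u) (f v)"
  shows "reach H (f a) (f b)"
  using assms(1) unfolding reach_def[of E]
  by (induction rule: rtranclp_induct) (auto intro: reach_trans assms(2))

lemma reach_mono: "reach E a b \<Longrightarrow> E \<subseteq> H \<Longrightarrow> reach H a b"
  using reach_image[of E a b H "\<lambda>x. x"] by (auto intro: reach_edge)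

lemma reach_isolated:
  assumes "reach F u w" "w \<notin> \<Union>F"
  shows "u = w"
  using assms unfolding reach_def by (cases rule: rtranclp.cases) auto

lemma successively_reach:
  assumes "xs \<noteq> []" "successively (\<lambda>u v. {u, v} \<in> F) xs"
  shows "reach F (hd xs) (last xs)"
  using assms
proof (induction xs)
  case (Cons a xs)
  then show ?case
    by (cases "xs = []") (auto simp: successively_Cons intro: reach_trans reach_edge)
qed simp

lemma reach_distinct_path:
  assumes "reach F u v"
  obtains xs where "xs \<noteq> []" "hd xs = u" "last xs = v" "distinct xs"
    "successively (\<lambda>u v. {u, v} \<in> F) xs"
proof -
  have "\<exists>xs. xs \<noteq> [] \<and> hd xs = u \<and> last xs = v \<and> distinct xs
      \<and> successively (\<lambda>u v. {u, v} \<in> F) xs"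
    using assms unfolding reach_def
  proof (induction rule: converse_rtranclp_induct)
    case base
    show ?case by (intro exI[of _ "[v]"]) simp
  next
    case (step a b)
    then obtain xs where xs: "xs \<noteq> []" "hd xs = b" "last xs = v" "distinct xs"
      "successively (\<lambda>u v. {u, v} \<in> F) xs" by blast
    show ?case
    proof (cases "a \<in> set xs")
      case True
      then obtain ys zs where "xs = ys @ a # zs" by (auto simp: in_set_conv_decomp)
      with xs show ?thesis
        by (intro exI[of _ "a # zs"]) (auto simp: successively_append_iff)
    next
      case False
      with xs step show ?thesis
        by (intro exI[of _ "a # xs"]) (auto simp: successively_Cons)
    qed
  qed
  with that show ?thesis by blast
qed

lemma path_subset:
  assumes "successively (\<lambda>u v. {u, v} \<in> F) xs" "hd xs \<in> V" "\<Union>F \<subseteq> V"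
  shows "set xs \<subseteq> V"
  using assms(1,2)
proof (induction xs)
  case (Cons a xs)
  then have "xs \<noteq> [] \<Longrightarrow> {a, hd xs} \<subseteq> V"
    using assms(3) by (auto simp: successively_Cons)
  with Cons show ?case by (cases "xs = []") (auto simp: successively_Cons)
qed simp

lemma uconnected_iff_reach:
  assumes "\<Union>F \<subseteq> V"
  shows "uconnected \<lparr>uverts = V, uedges = F\<rparr> \<longleftrightarrow> V \<noteq> {} \<and> (\<forall>u\<in>V. \<forall>v\<in>V. reach F u v)"
proof -
  have "(\<exists>xs. uwalk \<lparr>uverts = V, uedges = F\<rparr> xs \<and> hd xs = u \<and> last xs = v) \<longleftrightarrow> reach F u v"
    if "u \<in> V" for u v
  proof
    assume "\<exists>xs. uwalk \<lparr>uverts = V, uedges = F\<rparr> xs \<and> hd xs = u \<and> last xs = v"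
    then show "reach F u v"
      using successively_reach by (auto simp: uwalk_def)
  next
    assume "reach F u v"
    then show "\<exists>xs. uwalk \<lparr>uverts = V, uedges = F\<rparr> xs \<and> hd xs = u \<and> last xs = v"
      by (metis reach_distinct_path path_subset[OF _ _ assms] uwalk_def ugraph.select_convs that)
  qed
  then show ?thesis by (auto simp: uconnected_def)
qed

text \<open>As the entries are distinct, two neighbours can form the closing edge only by being the
  first and the last entry, which happens only in a list of length 2.\<close>

lemma cycle_avoids_closing_edge:
  assumes "distinct xs" "length xs \<ge> 3" "successively (\<lambda>u v. {u, v} \<in> F) xs"
  shows "successively (\<lambda>u v. {u, v} \<in> F - {{last xs, hd xs}}) xs"
  unfolding successively_conv_nth
proof (intro allI impI)
  fix i assume i: "Suc i < length xs"
  have "xs \<noteq> []" using i by auto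
  then have "last xs = xs ! (length xs - 1)" "hd xs = xs ! 0"
    by (auto simp: last_conv_nth hd_conv_nth)
  moreover have "xs ! i \<noteq> xs ! (length xs - 1)" "Suc i = length xs - 1 \<Longrightarrow> xs ! i \<noteq> xs ! 0"
    "xs ! Suc i \<noteq> xs ! 0" 
    using i assms by (subst nth_eq_iff_index_eq; auto)+
  moreover have "xs ! Suc i = xs ! (length xs - 1) \<Longrightarrow> Suc i = length xs - 1"
    using i assms by (subst (asm) nth_eq_iff_index_eq) auto
  ultimately have "{xs ! i, xs ! Suc i} \<noteq> {last xs, hd xs}"
    by (auto simp: doubleton_eq_iff)
  with assms(3) i show "{xs ! i, xs ! Suc i} \<in> F - {{last xs, hd xs}}"
    by (auto simp: successively_conv_nth)
qed

text \<open>A repetition-free path from \<open>u\<close> to \<open>v\<close> that avoids the edge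
  \<open>{u, v}\<close> closes up with it to a cycle. Conversely, a cycle minus its closing edge is
  a detour showing that this edge is no bridge.\<close>

lemma no_ucycle_iff:
  assumes "\<Union>F \<subseteq> V" "\<forall>e\<in>F. card e = 2"
  shows "(\<nexists>xs. ucycle \<lparr>uverts = V, uedges = F\<rparr> xs) \<longleftrightarrow> acyclic_edges F"
proof
  assume no: "\<nexists>xs. ucycle \<lparr>uverts = V, uedges = F\<rparr> xs"
  show "acyclic_edges F"
    unfolding acyclic_edges_def
  proof (intro allI impI notI)
    fix u v assume e: "{u, v} \<in> F" and r: "reach (F - {{u, v}}) u v"
    obtain xs where xs: "xs \<noteq> []" "hd xs = u" "last xs = v" "distinct xs"
      and s: "successively (\<lambda>a b. {a, b} \<in> F - {{u, v}}) xs"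
      using reach_distinct_path[OF r] by blast
    have "u \<noteq> v" using e assms(2) by fastforce
    \<comment> \<open>Length 1 forces \<open>u = v\<close>, and length 2 would make the path the
      deleted edge itself.\<close>
    have "length xs \<ge> 3"
    proof (rule ccontr)
      assume "\<not> length xs \<ge> 3"
      then consider "length xs = 0" | "length xs = 1" | "length xs = 2" by linarith
      then show False
        using xs s \<open>u \<noteq> v\<close> by cases (auto simp: length_Suc_conv numeral_2_eq_2)
    qed
    moreover have sF: "successively (\<lambda>a b. {a, b} \<in> F) xs"
      using s by (rule successively_mono) auto
    moreover have "set xs \<subseteq> V"
      using path_subset[OF sF _ assms(1)] xs e assms(1) by blast
    ultimately have "ucycle \<lparr>uverts = V, uedges = F\<rparr> xs"
      using xs e by (auto simp: ucycle_def uwalk_def insert_commute)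
    with no show False by blast
  qed
next
  assume ac: "acyclic_edges F"
  show "\<nexists>xs. ucycle \<lparr>uverts = V, uedges = F\<rparr> xs"
  proof
    assume "\<exists>xs. ucycle \<lparr>uverts = V, uedges = F\<rparr> xs"
    then obtain xs where xs: "xs \<noteq> []" "distinct xs" "length xs \<ge> 3" "{last xs, hd xs} \<in> F"
      "successively (\<lambda>u v. {u, v} \<in> F) xs"
      by (auto simp: ucycle_def uwalk_def)
    then have "reach (F - {{last xs, hd xs}}) (hd xs) (last xs)"
      using cycle_avoids_closing_edge successively_reach by metis
    with ac xs(4) show False
      by (auto simp: acyclic_edges_def dest: reach_sym)
  qed
qed

lemma tree_on_iff:
  "tree_on V F \<longleftrightarrow> finite V \<and> V \<noteq> {} \<and> (\<forall>e\<in>F. e \<subseteq> V \<and> card e = 2)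
     \<and> (\<forall>u\<in>V. \<forall>v\<in>V. reach F u v) \<and> acyclic_edges F"
proof (cases "\<forall>e\<in>F. e \<subseteq> V \<and> card e = 2")
  case True
  then have "\<Union>F \<subseteq> V" "\<forall>e\<in>F. card e = 2" by auto
  from True uconnected_iff_reach[OF this(1)] no_ucycle_iff[OF this] show ?thesis
    unfolding utree_def simple_ugraph_def ugraph.select_convs by blast
qed (auto simp: utree_def simple_ugraph_def)

subsection \<open>Pendant and subdividing vertices\<close>

lemma reach_pendant:
  assumes "w \<notin> \<Union>H" "a \<noteq> w" "b \<noteq> w"
  shows "reach (insert {x, w} H) a b \<longleftrightarrow> reach H a b"
proof
  assume r: "reach (insert {x, w} H) a b"
  define f where "f v = (if v = w then x else v)" for v
  have "reach H (f a) (f b)"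
    using r by (rule reach_image) (use assms in \<open>auto simp: f_def doubleton_eq_iff intro: reach_edge\<close>)
  then show "reach H a b" using assms by (simp add: f_def)
qed (auto elim: reach_mono)

text \<open>Sending \<open>w\<close> to \<open>x\<close> shrinks \<open>{x, w}\<close> to a point
  and turns \<open>{w, y}\<close> into \<open>{x, y}\<close>; conversely the path
  \<open>x, w, y\<close> replaces the edge \<open>{x, y}\<close>.\<close>

lemma reach_subdivide:
  assumes "w \<notin> \<Union>H" "a \<noteq> w" "b \<noteq> w"
  shows "reach (insert {w, y} (insert {x, w} H)) a b \<longleftrightarrow> reach (insert {x, y} H) a b"
proof
  assume r: "reach (insert {w, y} (insert {x, w} H)) a b"
  define f where "f v = (if v = w then x else v)" for v
  have xy: "reach (insert {x, y} H) x y" "reach (insert {x, y} H) y x"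
    by (auto intro!: reach_edge simp: insert_commute)
  have "reach (insert {x, y} H) (f a) (f b)"
    using r by (rule reach_image)
      (use assms xy in \<open>auto simp: f_def doubleton_eq_iff intro: reach_edge\<close>)
  then show "reach (insert {x, y} H) a b" using assms by (simp add: f_def)
next
  let ?K = "insert {w, y} (insert {x, w} H)"
  have "reach ?K x w" "reach ?K w y" by (auto intro: reach_edge)
  then have xy: "reach ?K x y" by (rule reach_trans)
  assume "reach (insert {x, y} H) a b"
  from reach_image[OF this, where f = "\<lambda>v. v" and H = ?K] show "reach ?K a b"
    using xy by (auto simp: doubleton_eq_iff intro: reach_edge reach_sym)
qed

text \<open>The connectivity argument shared by the pendant and the subdivision case:
  \<open>w\<close> is tied to \<open>x\<close>, so only the old vertices matter. \<open>G\<close>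
  plays the edge set before the modification.\<close>

lemma reach_all_insert:
  assumes "x \<in> V" "reach F x w"
    and eq: "\<And>u v. u \<in> V \<Longrightarrow> v \<in> V \<Longrightarrow> reach F u v \<longleftrightarrow> reach G u v"
  shows "(\<forall>u\<in>insert w V. \<forall>v\<in>insert w V. reach F u v) \<longleftrightarrow> (\<forall>u\<in>V. \<forall>v\<in>V. reach G u v)"
proof
  assume all: "\<forall>u\<in>V. \<forall>v\<in>V. reach G u v"
  have "reach F u x" if "u \<in> insert w V" for u
    using that all assms reach_sym by (cases "u = w") auto
  then show "\<forall>u\<in>insert w V. \<forall>v\<in>insert w V. reach F u v"
    by (meson reach_sym reach_trans)
qed (use eq in simp)

text \<open>The edge at \<open>w\<close> is a bridge because \<open>w\<close> is isolated without
  it, and a leaf does not affect whether another edge is a bridge.\<close>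

lemma tree_on_pendant:
  assumes "x \<in> V" "w \<notin> V" "\<Union>F \<subseteq> V"
  shows "tree_on (insert w V) (insert {x, w} F) \<longleftrightarrow> tree_on V F"
proof -
  let ?F = "insert {x, w} F"
  have w: "w \<notin> \<Union>F" "x \<noteq> w" "{x, w} \<notin> F" using assms by auto
  have edges: "(\<forall>e\<in>?F. e \<subseteq> insert w V \<and> card e = 2) \<longleftrightarrow> (\<forall>e\<in>F. e \<subseteq> V \<and> card e = 2)"
    using assms w by auto
  have xw: "reach ?F x w" by (auto intro: reach_edge)
  have eq: "reach ?F u v \<longleftrightarrow> reach F u v" if "u \<in> V" "v \<in> V" for u v
    using reach_pendant[OF w(1), of u v x] that assms by auto
  have conn: "(\<forall>u\<in>insert w V. \<forall>v\<in>insert w V. reach ?F u v) \<longleftrightarrow> (\<forall>u\<in>V. \<forall>v\<in>V. reach F u v)"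
    using assms(1) xw eq by (rule reach_all_insert)
  have ac: "acyclic_edges ?F \<longleftrightarrow> acyclic_edges F"
  proof -
    have "?F - {{x, w}} = F" using w by auto
    then have nr: "\<not> reach (?F - {{x, w}}) x w"
      using w(2) reach_isolated[OF _ w(1)] by auto
    have 1: "\<not> reach (?F - {{u, v}}) u v" if "{u, v} = {x, w}" for u v
      using nr unfolding that reach_doubleton[OF that] .
    have 2: "reach (?F - {{u, v}}) u v \<longleftrightarrow> reach (F - {{u, v}}) u v" if "{u, v} \<in> F" for u v
    proof -
      have "?F - {{u, v}} = insert {x, w} (F - {{u, v}})" using that w by auto
      moreover have "w \<notin> \<Union>(F - {{u, v}})" "u \<noteq> w" "v \<noteq> w" using that w by auto
      ultimately show ?thesis by (simp add: reach_pendant)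
    qed
    show ?thesis unfolding acyclic_edges_def using 1 2 by (metis insert_iff)
  qed
  show ?thesis unfolding tree_on_iff using edges conn ac assms by auto
qed

text \<open>Either half of the subdivided edge is a bridge exactly when \<open>{x, y}\<close> is,
  namely when \<open>F\<close> alone does not join \<open>x\<close> to \<open>y\<close>. If
  \<open>{x, y}\<close> were in \<open>F\<close>, the left side would contain a triangle while the
  right side could still be a tree.\<close>

lemma tree_on_subdivide:
  assumes "x \<in> V" "y \<in> V" "x \<noteq> y" "w \<notin> V" "\<Union>F \<subseteq> V" "{x, y} \<notin> F"
  shows "tree_on (insert w V) (insert {w, y} (insert {x, w} F)) \<longleftrightarrow> tree_on V (insert {x, y} F)"
proof -
  let ?F = "insert {w, y} (insert {x, w} F)" and ?G = "insert {x, y} F"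
  have w: "w \<notin> \<Union>F" "x \<noteq> w" "y \<noteq> w" "{x, w} \<notin> F" "{w, y} \<notin> F" "{x, w} \<noteq> {w, y}"
    using assms by (auto simp: doubleton_eq_iff)
  have edges: "(\<forall>e\<in>?F. e \<subseteq> insert w V \<and> card e = 2) \<longleftrightarrow> (\<forall>e\<in>?G. e \<subseteq> V \<and> card e = 2)"
    using assms w by auto
  have xw: "reach ?F x w" by (auto intro: reach_edge)
  have eq: "reach ?F u v \<longleftrightarrow> reach ?G u v" if "u \<in> V" "v \<in> V" for u v
    using reach_subdivide[OF w(1), of u v y x] that assms by auto
  have conn: "(\<forall>u\<in>insert w V. \<forall>v\<in>insert w V. reach ?F u v) \<longleftrightarrow> (\<forall>u\<in>V. \<forall>v\<in>V. reach ?G u v)"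
    using assms(1) xw eq by (rule reach_all_insert)
  have 0: "?G - {{x, y}} = F" using assms by auto
  have 1: "reach (?F - {{u, v}}) u v \<longleftrightarrow> reach F x y" if "{u, v} = {x, w}" for u v
  proof -
    have *: "?F - {{x, w}} = insert {y, w} F" using w by (auto simp: insert_commute)
    have "reach (insert {y, w} F) x w \<longleftrightarrow> reach (insert {y, w} F) x y"
      by (meson reach_edge reach_sym reach_trans insertI1)
    also have "\<dots> \<longleftrightarrow> reach F x y" using w by (intro reach_pendant) auto
    finally show ?thesis unfolding that * reach_doubleton[OF that] .
  qed
  have 2: "reach (?F - {{u, v}}) u v \<longleftrightarrow> reach F x y" if "{u, v} = {w, y}" for u v
  proof -
    have *: "?F - {{w, y}} = insert {x, w} F" using w by auto
    have "reach (insert {x, w} F) w y \<longleftrightarrow> reach (insert {x, w} F) x y"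
      by (meson reach_edge reach_sym reach_trans insertI1)
    also have "\<dots> \<longleftrightarrow> reach F x y" using w by (intro reach_pendant) auto
    finally show ?thesis unfolding that * reach_doubleton[OF that] .
  qed
  have 3: "reach (?F - {{u, v}}) u v \<longleftrightarrow> reach (?G - {{u, v}}) u v" if "{u, v} \<in> F" for u v
  proof -
    have "?F - {{u, v}} = insert {w, y} (insert {x, w} (F - {{u, v}}))"
      "?G - {{u, v}} = insert {x, y} (F - {{u, v}})"
      using that w assms(6) by auto
    moreover have "w \<notin> \<Union>(F - {{u, v}})" "u \<noteq> w" "v \<noteq> w" using that w by auto
    ultimately show ?thesis by (simp add: reach_subdivide)
  qed
  have 4: "reach (?G - {{u, v}}) u v \<longleftrightarrow> reach F x y" if "{u, v} = {x, y}" for u v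
    unfolding that 0 reach_doubleton[OF that] ..
  have ac: "acyclic_edges ?F \<longleftrightarrow> acyclic_edges ?G"
    unfolding acyclic_edges_def using 1 2 3 4 by (metis insert_iff)
  show ?thesis unfolding tree_on_iff using edges conn ac assms by auto
qed

lemma not_tree_on_triangle:
  assumes "x \<noteq> y" "w \<noteq> x" "w \<noteq> y" "{x, y} \<in> F" "{x, w} \<in> F" "{w, y} \<in> F"
  shows "\<not> tree_on V F"
proof -
  have "reach (F - {{x, y}}) x w" "reach (F - {{x, y}}) w y"
    using assms by (auto intro!: reach_edge simp: doubleton_eq_iff)
  then have "reach (F - {{x, y}}) x y" by (rule reach_trans)
  then show ?thesis using assms by (auto simp: tree_on_iff acyclic_edges_def)
qed

lemma not_tree_on_isolated:
  assumes "x \<in> V" "w \<notin> V" "\<Union>F \<subseteq> V"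
  shows "\<not> tree_on (insert w V) F"
proof
  assume "tree_on (insert w V) F"
  then have "reach F x w" using assms(1) by (simp add: tree_on_iff)
  then have "x = w" using assms(2,3) by (intro reach_isolated) auto
  then show False using assms by simp
qed

subsection \<open>Counting spanning trees\<close>

text \<open>The second count is over the two-component spanning forests of \<open>(V, E)\<close> that separate
  \<open>x\<close> from \<open>y\<close>.\<close>

definition tree_counts :: "'v set \<Rightarrow> 'v set set \<Rightarrow> 'v \<Rightarrow> 'v \<Rightarrow> nat \<Rightarrow> nat \<Rightarrow> bool" where
  "tree_counts V E x y a b \<longleftrightarrow>
     finite V \<and> \<Union>E \<subseteq> V \<and> x \<in> V \<and> y \<in> V \<and> x \<noteq> y \<and>
     card {F. F \<subseteq> E \<and> tree_on V F} = a \<and>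
     card {F. F \<subseteq> E - {{x, y}} \<and> tree_on V (insert {x, y} F)} = b"

lemma tree_counts_swap: "tree_counts V E x y a b \<Longrightarrow> tree_counts V E y x a b"
  by (auto simp: tree_counts_def insert_commute)

lemma card_Un_insert_image:
  assumes "finite X" "finite Y" "\<forall>F\<in>X \<union> Y. e \<notin> F"
  shows "card (X \<union> insert e ` Y) = card X + card Y"
proof -
  have "inj_on (insert e) Y" using assms(3) by (intro inj_onI) (metis UnCI insert_ident)
  then show ?thesis using assms by (subst card_Un_disjoint) (auto simp: card_image)
qed

text \<open>The split underlying deletion and contraction, as a union that
  \<open>card_Un_insert_image\<close> can count.\<close>

lemma subset_insert_cases:
  assumes "e \<notin> E"
  shows "{F. F \<subseteq> insert e E \<and> P F} = {F. F \<subseteq> E \<and> P F} \<union> insert e ` {F. F \<subseteq> E \<and> P (insert e F)}"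
proof (intro equalityI subsetI)
  fix F assume F: "F \<in> {F. F \<subseteq> insert e E \<and> P F}"
  show "F \<in> {F. F \<subseteq> E \<and> P F} \<union> insert e ` {F. F \<subseteq> E \<and> P (insert e F)}"
  proof (cases "e \<in> F")
    case True
    with F show ?thesis by (intro UnI2 image_eqI[of _ _ "F - {e}"]) (auto simp: insert_absorb)
  qed (use F in auto)
qed auto

text \<open>A spanning tree must use \<open>{x, w}\<close>, the only edge at \<open>w\<close>, and
  \<open>w\<close> is then a leaf: this gives \<open>a\<close>. In the second count
  \<open>{w, y}\<close> is present: without \<open>{x, w}\<close> the vertex \<open>w\<close> is a
  leaf at \<open>y\<close>, which contributes \<open>a\<close>; with it, \<open>w\<close> subdivides
  \<open>{x, y}\<close>, which contributes \<open>b\<close>.\<close>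

lemma tree_counts_pendant:
  assumes "tree_counts V E x y a b" "w \<notin> V"
  shows "tree_counts (insert w V) (insert {x, w} E) w y a (a + b)"
proof -
  have V: "finite V" "\<Union>E \<subseteq> V" "x \<in> V" "y \<in> V" "x \<noteq> y"
    and a: "card {F. F \<subseteq> E \<and> tree_on V F} = a"
    and b: "card {F. F \<subseteq> E - {{x, y}} \<and> tree_on V (insert {x, y} F)} = b"
    using assms(1) by (auto simp: tree_counts_def)
  have "finite E" using V by (meson finite_UnionD finite_subset)
  then have fin: "finite {F. F \<subseteq> E \<and> P F}" "finite {F. F \<subseteq> E - {{x, y}} \<and> P F}" for P by auto
  have e: "{x, w} \<notin> E" "{w, y} \<notin> insert {x, w} E"
    using V assms(2) by (auto simp: doubleton_eq_iff)
  have sub: "\<Union>F \<subseteq> V" if "F \<subseteq> E" for F using that V by auto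
  have "{F. F \<subseteq> insert {x, w} E \<and> tree_on (insert w V) F}
      = {} \<union> insert {x, w} ` {F. F \<subseteq> E \<and> tree_on V F}"
    unfolding subset_insert_cases[OF e(1)]
    using not_tree_on_isolated[OF V(3) assms(2) sub] tree_on_pendant[OF V(3) assms(2) sub] by auto
  then have 1: "card {F. F \<subseteq> insert {x, w} E \<and> tree_on (insert w V) F} = a"
    using e fin a by (simp only:) (subst card_Un_insert_image, auto)
  have A: "tree_on (insert w V) (insert {w, y} F) \<longleftrightarrow> tree_on V F" if "F \<subseteq> E" for F
    using tree_on_pendant[OF V(4) assms(2) sub[OF that]] by (simp add: insert_commute)
  \<comment> \<open>If \<open>F\<close> contains \<open>{x, y}\<close>, both sides fail: the left by
    the triangle \<open>x, w, y\<close>, the right by the exclusion of that edge.\<close>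
  have B: "F \<subseteq> E \<and> tree_on (insert w V) (insert {w, y} (insert {x, w} F))
      \<longleftrightarrow> F \<subseteq> E - {{x, y}} \<and> tree_on V (insert {x, y} F)" for F
  proof (cases "{x, y} \<in> F")
    case True
    then show ?thesis
      using not_tree_on_triangle[of x y w "insert {w, y} (insert {x, w} F)"] V assms(2) by auto
  next
    case xy: False
    show ?thesis
    proof (cases "F \<subseteq> E")
      case True
      then show ?thesis
        using tree_on_subdivide[OF V(3,4,5) assms(2) sub[OF True] xy] xy by blast
    qed auto
  qed
  have "insert {x, w} E - {{w, y}} = insert {x, w} E" using e by auto
  then have "{F. F \<subseteq> insert {x, w} E - {{w, y}} \<and> tree_on (insert w V) (insert {w, y} F)}
    = {F. F \<subseteq> E \<and> tree_on (insert w V) (insert {w, y} F)}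
      \<union> insert {x, w} ` {F. F \<subseteq> E \<and> tree_on (insert w V) (insert {w, y} (insert {x, w} F))}"
    by (simp only: subset_insert_cases[OF e(1)])
  also have "\<dots> = {F. F \<subseteq> E \<and> tree_on V F}
      \<union> insert {x, w} ` {F. F \<subseteq> E - {{x, y}} \<and> tree_on V (insert {x, y} F)}"
    unfolding B using A by blast
  also have "card \<dots> = a + b"
    using e fin a b by (subst card_Un_insert_image) auto
  finally show ?thesis
    using V assms(2) 1 by (auto simp: tree_counts_def)
qed

text \<open>Trees without the new edge number \<open>a\<close>, those with it \<open>b\<close>. The
  second count removes \<open>{x, y}\<close> from the edge set anyway, so it stays.\<close>

lemma tree_counts_close:
  assumes "tree_counts V E x y a b" "{x, y} \<notin> E"
  shows "tree_counts V (insert {x, y} E) x y (a + b) b"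
proof -
  have V: "finite V" "\<Union>E \<subseteq> V" "x \<in> V" "y \<in> V" "x \<noteq> y"
    and a: "card {F. F \<subseteq> E \<and> tree_on V F} = a"
    and b: "card {F. F \<subseteq> E - {{x, y}} \<and> tree_on V (insert {x, y} F)} = b"
    using assms(1) by (auto simp: tree_counts_def)
  have "finite E" using V by (meson finite_UnionD finite_subset)
  moreover have "E - {{x, y}} = E" "insert {x, y} E - {{x, y}} = E" using assms(2) by auto
  ultimately show ?thesis
    using V a b assms(2) unfolding tree_counts_def
    by (simp only: subset_insert_cases[OF assms(2)]) (subst card_Un_insert_image; auto)
qed

lemma tree_counts_pendant_close:
  assumes "tree_counts V E x y a b" "w \<notin> V"
  shows "tree_counts (insert w V) (insert {w, y} (insert {x, w} E)) w y (2 * a + b) (a + b)"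
proof -
  have "{w, y} \<notin> insert {x, w} E"
    using assms by (auto simp: tree_counts_def doubleton_eq_iff)
  from tree_counts_close[OF tree_counts_pendant[OF assms] this] show ?thesis
    by (simp add: mult_2 add.assoc)
qed

lemma tree_counts_single_edge:
  assumes "x \<noteq> y"
  shows "tree_counts {x, y} {{x, y}} x y 1 1"
proof -
  have "\<not> reach {} x y" using assms reach_isolated[of "{}" x y] by auto
  then have "acyclic_edges {{x, y}}"
    by (auto simp: acyclic_edges_def doubleton_eq_iff dest: reach_sym)
  then have t: "tree_on {x, y} {{x, y}}"
    using assms by (auto simp: tree_on_iff insert_commute intro!: reach_edge)
  have nt: "\<not> tree_on {x, y} {}"
    using \<open>\<not> reach {} x y\<close> by (auto simp: tree_on_iff)
  have "{F. F \<subseteq> {{x, y}} \<and> tree_on {x, y} F} = {{{x, y}}}"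
    "{F. F \<subseteq> {{x, y}} - {{x, y}} \<and> tree_on {x, y} (insert {x, y} F)} = {{}}"
    using t nt by (auto simp: subset_singleton_iff)
  then show ?thesis using assms by (simp add: tree_counts_def)
qed

lemma complexity_eq_card_trees:
  "complexity G = card {F. F \<subseteq> uedges G \<and> tree_on (uverts G) F}"
proof -
  have "{T. spanning_utree T G}
      = (\<lambda>F. \<lparr>uverts = uverts G, uedges = F\<rparr>) ` {F. F \<subseteq> uedges G \<and> tree_on (uverts G) F}"
    (is "_ = ?g ` ?X")
  proof (intro equalityI subsetI)
    fix T :: "'a ugraph" assume "T \<in> {T. spanning_utree T G}"
    then have "T = ?g (uedges T)" "uedges T \<in> ?X" 
      by (auto simp: spanning_utree_def) (metis ugraph.surjective unit.exhaust)
    then show "T \<in> ?g ` ?X" by blast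
  qed (auto simp: spanning_utree_def)
  moreover have "inj_on ?g ?X" by (auto simp: inj_on_def)
  ultimately show ?thesis by (simp add: complexity_def card_image)
qed

subsection \<open>The octagonal-quadrilateral network\<close>

text \<open>Each period adds four pairs of rail edges, the last two of them closed by a rung. In
  matrices: \<open>[[3,1],[2,1]]^2 [[1,0],[2,1]]^2 = [[27,4],[20,3]]\<close>.\<close>

fun oct_quad_counts :: "nat \<Rightarrow> nat \<times> nat" where
  "oct_quad_counts 0 = (1, 1)"
| "oct_quad_counts (Suc n) = (let (a, b) = oct_quad_counts n in (27 * a + 4 * b, 20 * a + 3 * b))"

lemma tree_counts_rails_step:
  assumes "tree_counts V E x y a b" "x' \<notin> V" "y' \<notin> V" "x' \<noteq> y'"
  shows "tree_counts (insert x' (insert y' V)) (insert {x, x'} (insert {y, y'} E)) x' y' a (2 * a + b)"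
proof -
  \<comment> \<open>\<open>tree_counts_pendant\<close> moves the first mark only, so the marks are
    swapped before and after the extension at \<open>y\<close>.\<close>
  have "tree_counts (insert y' V) (insert {y, y'} E) x y' a (a + b)"
    by (rule tree_counts_swap[OF tree_counts_pendant[OF tree_counts_swap[OF assms(1)] assms(3)]])
  from tree_counts_pendant[OF this, of x'] show ?thesis
    using assms by (simp add: mult_2 add.assoc)
qed

lemma tree_counts_rung_step:
  assumes "tree_counts V E x y a b" "x' \<notin> V" "y' \<notin> V" "x' \<noteq> y'"
  shows "tree_counts (insert x' (insert y' V))
    (insert {x', y'} (insert {x, x'} (insert {y, y'} E))) x' y' (3 * a + b) (2 * a + b)"
proof -
  have "tree_counts (insert y' V) (insert {y, y'} E) x y' a (a + b)"
    by (rule tree_counts_swap[OF tree_counts_pendant[OF tree_counts_swap[OF assms(1)] assms(3)]])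
  note close = tree_counts_pendant_close[OF this, of x']
  have "2 * a + (a + b) = 3 * a + b" "a + (a + b) = 2 * a + b" by simp_all
  with close show ?thesis using assms by simp
qed

text \<open>At \<open>n = 0\<close> only the rung at \<open>j = 1\<close> remains, so the induction
  can start from a single edge, below the range of the theorem.\<close>

lemma oct_quad_network_0:
  "uverts (oct_quad_network 0) = {Plain 1, Primed 1}"
  "uedges (oct_quad_network 0) = {{Plain 1, Primed 1}}"
  by (auto simp: oct_quad_network_def)

text \<open>Among the new indices only \<open>m+3\<close> and \<open>m+4\<close> are 0 or 1 modulo 4
  and carry rungs. Read from the inside out, the insertions follow the four growth steps, so that
  the chained steps match them literally.\<close>

lemma oct_quad_network_Suc:
  fixes n :: nat
  defines "m \<equiv> 4 * n + 1"
  shows "uverts (oct_quad_network (Suc n)) =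
      insert (Plain (m+4)) (insert (Primed (m+4)) (insert (Plain (m+3)) (insert (Primed (m+3))
      (insert (Plain (m+2)) (insert (Primed (m+2)) (insert (Plain (m+1)) (insert (Primed (m+1))
      (uverts (oct_quad_network n)))))))))" (is ?V)
    and "uedges (oct_quad_network (Suc n)) =
      insert {Plain (m+4), Primed (m+4)}
      (insert {Plain (m+3), Plain (m+4)} (insert {Primed (m+3), Primed (m+4)}
      (insert {Plain (m+3), Primed (m+3)}
      (insert {Plain (m+2), Plain (m+3)} (insert {Primed (m+2), Primed (m+3)}
      (insert {Plain (m+1), Plain (m+2)} (insert {Primed (m+1), Primed (m+2)}
      (insert {Plain m, Plain (m+1)} (insert {Primed m, Primed (m+1)}
      (uedges (oct_quad_network n)))))))))))" (is ?E)
proof -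
  have "{1..4 * Suc n + 1} = insert (m+4) (insert (m+3) (insert (m+2) (insert (m+1) {1..4*n+1})))"
    by (auto simp: m_def)
  then show ?V by (auto simp: oct_quad_network_def)
  have *: "1 \<le> j \<and> j \<le> 4 * Suc n \<longleftrightarrow> j = m \<or> j = m+1 \<or> j = m+2 \<or> j = m+3 \<or> (1 \<le> j \<and> j \<le> 4*n)"
    for j by (auto simp: m_def)
  have **: "j = 1 \<or> (4 \<le> j \<and> j \<le> 4 * Suc n + 1 \<and> (j mod 4 = 0 \<or> j mod 4 = 1)) \<longleftrightarrow>
     j = m+3 \<or> j = m+4 \<or> (j = 1 \<or> (4 \<le> j \<and> j \<le> 4*n+1 \<and> (j mod 4 = 0 \<or> j mod 4 = 1)))"
    for j unfolding m_def by auto presburger+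
  have ins: "{f j | j. j = c \<or> P j} = insert (f c) {f j | j. P j}" for f :: "nat \<Rightarrow> vertex set" and c P
    by auto
  have n: "m + 1 + 1 = m + 2" "m + 2 + 1 = m + 3" "m + 3 + 1 = m + 4" by simp_all
  show ?E unfolding oct_quad_network_def ugraph.select_convs * ** ins n
    by (intro set_eqI) (simp only: Un_iff insert_iff disj_ac)
qed

lemma tree_counts_oct_quad_network:
  "tree_counts (uverts (oct_quad_network n)) (uedges (oct_quad_network n))
     (Plain (4*n+1)) (Primed (4*n+1)) (fst (oct_quad_counts n)) (snd (oct_quad_counts n))"
proof (induction n)
  case 0
  show ?case using tree_counts_single_edge[of "Plain 1" "Primed 1"]
    by (simp add: oct_quad_network_0)
next
  case (Suc n)
  define m where "m = 4 * n + 1"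
  obtain a b where ab: "oct_quad_counts n = (a, b)" by fastforce
  have notin: "Plain k \<notin> uverts (oct_quad_network n)" "Primed k \<notin> uverts (oct_quad_network n)"
    if "k > m" for k using that by (auto simp: oct_quad_network_def m_def)
  have "tree_counts (uverts (oct_quad_network n)) (uedges (oct_quad_network n))
     (Plain m) (Primed m) a b" using Suc ab by (simp add: m_def)
  note s1 = tree_counts_rails_step[OF this, of "Plain (m+1)" "Primed (m+1)"]
  note s2 = tree_counts_rails_step[OF s1, of "Plain (m+2)" "Primed (m+2)"]
  note s3 = tree_counts_rung_step[OF s2, of "Plain (m+3)" "Primed (m+3)"]
  note s4 = tree_counts_rung_step[OF s3, of "Plain (m+4)" "Primed (m+4)"]
  have e: "4 * Suc n + 1 = m + 4" by (simp add: m_def)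
  \<comment> \<open>The counts are the unsimplified composite produced by \<open>s4\<close>; they
    equal \<open>27a + 4b\<close> and \<open>20a + 3b\<close>.\<close>
  have "tree_counts (uverts (oct_quad_network (Suc n))) (uedges (oct_quad_network (Suc n)))
     (Plain (m+4)) (Primed (m+4)) (3 * (3 * a + (2 * a + (2 * a + b))) + (2 * a + (2 * a + (2 * a + b))))
      (2 * (3 * a + (2 * a + (2 * a + b))) + (2 * a + (2 * a + (2 * a + b))))"
    unfolding oct_quad_network_Suc m_def[symmetric]
    by (rule s4) (simp_all add: notin)
  then show ?case unfolding e by (simp add: ab algebra_simps)
qed

text \<open>\<open>(4 + s, 2 + s)\<close> and \<open>(4 - s, 2 - s)\<close> are eigenvectors of the
  matrix for \<open>15 + 4s\<close> and \<open>15 - 4s\<close>, and the start \<open>(1, 1)\<close>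
  is their difference divided by \<open>2s\<close>.\<close>

lemma oct_quad_counts_closed_form:
  defines "s \<equiv> sqrt 14"
  shows "2 * s * fst (oct_quad_counts n) = (4 + s) * (15 + 4 * s) ^ n - (4 - s) * (15 - 4 * s) ^ n
     \<and> 2 * s * snd (oct_quad_counts n) = (2 + s) * (15 + 4 * s) ^ n - (2 - s) * (15 - 4 * s) ^ n"
proof (induction n)
  case 0
  show ?case by simp
next
  case (Suc n)
  obtain a b where ab: "oct_quad_counts n = (a, b)" by fastforce
  have s2: "s * s = 14" by (simp add: s_def)
  define X Y where "X = (15 + 4 * s) ^ n" and "Y = (15 - 4 * s) ^ n"
  from Suc have IH: "2 * s * a = (4 + s) * X - (4 - s) * Y" "2 * s * b = (2 + s) * X - (2 - s) * Y"
    by (simp_all add: ab X_def Y_def)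
  have "2 * s * (27 * real a + 4 * real b) = (4 + s) * ((15 + 4 * s) * X) - (4 - s) * ((15 - 4 * s) * Y)"
    using IH s2 by algebra
  moreover have "2 * s * (20 * real a + 3 * real b) = (2 + s) * ((15 + 4 * s) * X) - (2 - s) * ((15 - 4 * s) * Y)"
    using IH s2 by algebra
  ultimately show ?case by (simp add: ab X_def Y_def)
qed

subsection \<open>The product of sines\<close>

lemma prod_one_minus_roots_unity:
  assumes "n > 0"
  shows "(\<Prod>z\<in>{z::complex. z ^ n = 1} - {1}. 1 - z) = of_nat n"
proof -
  let ?S = "{z::complex. z ^ n = 1} - {1}"
  define p :: "complex poly" where "p = (\<Sum>k<n. monom 1 k)"
  define q :: "complex poly" where "q = (\<Prod>z\<in>?S. [:- z, 1:])"
  have fin: "finite ?S" using assms by (simp add: finite_roots_unity)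
  have card: "card ?S = n - 1"
    using assms card_roots_unity_eq[of n] by (simp add: card_Diff_singleton)
  \<comment> \<open>Both have degree at most \<open>n - 1\<close> with coefficient 1 there, and both
    vanish at the \<open>n - 1\<close> roots of unity other than 1; this determines them.\<close>
  have "p = q"
  proof (rule poly_eqI_degree_lead_coeff)
    show "degree q \<le> n - 1"
      using degree_prod_sum_le[OF fin, of "\<lambda>z. [:- z, 1:]"] card by (simp add: q_def)
    show "degree p \<le> n - 1"
      unfolding p_def by (intro degree_sum_le) (auto simp: degree_monom_eq)
    have "degree q = n - 1"
      unfolding q_def by (subst degree_prod_eq_sum_degree) (auto simp: card)
    then have "coeff q (n - 1) = 1"
      using lead_coeff_prod[of "\<lambda>z. [:- z, 1:]" ?S] by (simp add: q_def)
    moreover have "coeff p (n - 1) = 1"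
      using assms by (simp add: p_def coeff_sum)
    ultimately show "coeff p (n - 1) = coeff q (n - 1)" by simp
    show "n - 1 \<le> card ?S" by (simp add: card)
    fix z assume z: "z \<in> ?S"
    then have "poly p z = 0"
      by (simp add: p_def poly_sum poly_monom geometric_sum)
    moreover have "poly q z = 0"
      using z fin by (auto simp: q_def poly_prod)
    ultimately show "poly p z = poly q z" by simp
  qed
  then have "poly q 1 = poly p 1" by simp
  then show ?thesis by (simp add: p_def q_def poly_prod poly_sum poly_monom)
qed

text \<open>Take norms in the preceding product: for \<open>t = pi k / n\<close> one has
  \<open>1 - cis (2t) = -2i sin t cis t\<close>, and \<open>sin t\<close> is nonnegative on
  \<open>[0, pi]\<close>.\<close>

lemma prod_two_sin_pi:
  assumes "n > 0"
  shows "(\<Prod>k\<in>{1..<n}. 2 * sin (pi * real k / real n)) = real n"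
proof -
  let ?f = "\<lambda>k. cis (2 * pi * real k / real n)"
  have bij: "bij_betw ?f {1..<n} ({z. z ^ n = 1} - {1})"
  proof -
    have "bij_betw ?f ({..<n} - {0}) ({z. z ^ n = 1} - {?f 0})"
      using assms by (intro bij_betw_DiffI bij_betw_roots_unity) (auto simp: bij_betw_def)
    moreover have "{..<n} - {0} = {1..<n}" by auto
    ultimately show ?thesis by simp
  qed
  have norm: "norm (1 - ?f k) = 2 * sin (pi * real k / real n)" if "k \<in> {1..<n}" for k
  proof -
    define t where "t = pi * real k / real n"
    have "0 \<le> t" "t \<le> pi" using that by (auto simp: t_def field_simps)
    then have st: "sin t \<ge> 0" by (rule sin_ge_zero)
    have "1 - ?f k = - (2 * \<i> * sin t) * cis t"
      by (simp add: complex_eq_iff t_def cos_double_sin sin_double power2_eq_square mult.assoc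
          flip: times_divide_eq_right)
    then show ?thesis using st by (simp add: norm_mult t_def)
  qed
  have "(\<Prod>k\<in>{1..<n}. 2 * sin (pi * real k / real n)) = (\<Prod>k\<in>{1..<n}. norm (1 - ?f k))"
    by (intro prod.cong) (simp_all add: norm)
  also have "\<dots> = norm (\<Prod>k\<in>{1..<n}. 1 - ?f k)" by (simp add: prod_norm)
  also have "(\<Prod>k\<in>{1..<n}. 1 - ?f k) = of_nat n"
    using prod.reindex_bij_betw[OF bij, of "\<lambda>z. 1 - z"] prod_one_minus_roots_unity[OF assms] by simp
  finally show ?thesis by simp
qed

text \<open>In the product of doubled sines for \<open>2m\<close>, the factors at \<open>k\<close>
  and \<open>2m - k\<close> agree and the middle one is \<open>2 sin (pi/2) = 2\<close>. Hence half
  of the product, squared, is \<open>m\<close>, and each of its \<open>m - 1\<close> squared factors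
  carries a 4.\<close>

lemma prod_sin_squared:
  assumes "m > 0"
  shows "(\<Prod>k\<in>{1..<m}. (sin (pi * real k / (2 * real m)))\<^sup>2) = real m / 4 ^ (m - 1)"
proof -
  define g where "g k = 2 * sin (pi * real k / (2 * real m))" for k
  have "(\<Prod>k\<in>{1..<2*m}. g k) = 2 * real m"
    using prod_two_sin_pi[of "2 * m"] assms by (simp add: g_def)
  also have "{1..<2*m} = {1..<m} \<union> {m} \<union> {m<..<2*m}" using assms by auto
  also have "(\<Prod>k\<in>\<dots>. g k) = (\<Prod>k\<in>{1..<m}. g k) * g m * (\<Prod>k\<in>{m<..<2*m}. g k)"
    by (subst prod.union_disjoint; auto)+
  also have "(\<Prod>k\<in>{m<..<2*m}. g k) = (\<Prod>k\<in>{1..<m}. g k)"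
  proof (rule prod.reindex_bij_witness[of _ "\<lambda>k. 2 * m - k" "\<lambda>k. 2 * m - k"])
    fix k assume k: "k \<in> {m<..<2*m}"
    then have "pi * real (2 * m - k) / (2 * real m) = pi - pi * real k / (2 * real m)"
      using assms by (simp add: of_nat_diff field_simps)
    then show "g (2 * m - k) = g k" by (simp add: g_def)
  qed auto
  also have "g m = 2" using assms by (simp add: g_def)
  finally have "(\<Prod>k\<in>{1..<m}. (g k)\<^sup>2) = real m"
    by (simp add: power2_eq_square prod.distrib)
  also have "(\<Prod>k\<in>{1..<m}. (g k)\<^sup>2) = 4 ^ (m - 1) * (\<Prod>k\<in>{1..<m}. (sin (pi * real k / (2 * real m)))\<^sup>2)"
    by (simp add: g_def power_mult_distrib prod.distrib)
  finally show ?thesis by (simp add: field_simps)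
qed

subsection \<open>The closed formula\<close>

theorem theorem3p6:
  fixes n :: nat and A B :: real
  assumes "n \<ge> 1"
    and "A = 15 + 4 * sqrt 14"
    and "B = 15 - 4 * sqrt 14"
  shows "real (complexity (oct_quad_network n)) =
    4 ^ (4 * n) * ((116 + 31 * sqrt 14) * A ^ (n - 1) - (116 - 31 * sqrt 14) * B ^ (n - 1))
      / (sqrt 14 * (8 * real n + 2))
    * (\<Prod>k = 2..4*n+1. (sin (pi * (real k - 1) / (8 * real n + 2)))\<^sup>2)"
proof -
  define s where "s = sqrt 14"
  have s: "s * s = 14" "s > 0" by (simp_all add: s_def)
  obtain m where m: "n = Suc m" using assms(1) by (cases n) auto
  have "complexity (oct_quad_network n) = fst (oct_quad_counts n)"
    using tree_counts_oct_quad_network[of n]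
    by (simp add: complexity_eq_card_trees tree_counts_def)
  then have "2 * s * complexity (oct_quad_network n) = (4 + s) * A ^ n - (4 - s) * B ^ n"
    using oct_quad_counts_closed_form[of n] assms by (simp add: s_def)
  \<comment> \<open>One factor \<open>A\<close> or \<open>B\<close> is merged into its coefficient;
    since \<open>s * s = 14\<close>, the constant becomes 60 + 56 = 116.\<close>
  also have "\<dots> = (116 + 31 * s) * A ^ m - (116 - 31 * s) * B ^ m"
  proof -
    have "(4 + s) * A = 60 + 31 * s + 4 * (s * s)"
      unfolding assms(2) s_def[symmetric] by algebra
    moreover have "(4 - s) * B = 60 - 31 * s + 4 * (s * s)"
      unfolding assms(3) s_def[symmetric] by algebra
    ultimately show ?thesis by (simp add: m s(1) mult.assoc[symmetric])
  qed
  finally have trees: "2 * s * complexity (oct_quad_network n)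
      = (116 + 31 * s) * A ^ m - (116 - 31 * s) * B ^ m" .
  \<comment> \<open>The index is shifted by one, and \<open>8n + 2\<close> is read as twice
    \<open>4n + 1\<close>.\<close>
  have "(\<Prod>k = 2..4*n+1. (sin (pi * (real k - 1) / (8 * real n + 2)))\<^sup>2)
      = (\<Prod>k\<in>{1..<4*n+1}. (sin (pi * real k / (2 * real (4*n+1))))\<^sup>2)"
    by (rule prod.reindex_bij_witness[of _ Suc "\<lambda>k. k - 1"]) (auto simp: of_nat_diff algebra_simps)
  also have "\<dots> = real (4*n+1) / 4 ^ (4*n)"
    using prod_sin_squared[of "4*n+1"] by simp
  finally have sines: "(\<Prod>k = 2..4*n+1. (sin (pi * (real k - 1) / (8 * real n + 2)))\<^sup>2)
      = real (4*n+1) / 4 ^ (4*n)" .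
  \<comment> \<open>With \<open>P = 4^(4n)\<close> and \<open>K = 4n + 1\<close>, the sine product
    \<open>K / P\<close> reduces the prefactor \<open>P / (2K)\<close> to 1/2, which cancels the 2
    in \<open>2 * s * c\<close>.\<close>
  have "P * (2 * s * c) / (s * (2 * K)) * (K / P) = c" if "P \<noteq> 0" "K \<noteq> 0" for P c K :: real
    using that s(2) by simp
  note cancel = this[of "4 ^ (4*n)" "real (4*n+1)" "complexity (oct_quad_network n)"]
  have "8 * real n + 2 = 2 * real (4*n+1)" by simp
  then have "4 ^ (4*n) * (2 * s * complexity (oct_quad_network n)) / (s * (8 * real n + 2))
      * (real (4*n+1) / 4 ^ (4*n)) = real (complexity (oct_quad_network n))"
    by (simp only:) (rule cancel, simp_all only: of_nat_eq_0_iff power_eq_0_iff, simp_all)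
  then show ?thesis
    unfolding sines trees s_def[symmetric] by (simp add: m)
qed

end
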